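(* For every integer $a\ge 2$, \[M_2(a)\le 2+2\frac{\log a}{W\left(\frac12\log a\right)}.\] Consequently, as $a\to\infty$, \[M_2(a)=O\left(\frac{\log a}{\log\log a-\log\log\log a}\right).\]
   Context: $\left\{ {n \atop k} \right\}$ denotes the Stirling number of the second kind (number of partitions of an $n$-element set into $k$ non-empty blocks). For a non-negative integer $a$, $M_2(a)$ is the number of pairs $(n,k)$ of non-negative integers with $\left\{ {n \atop k} \right\}=a$, i.e. the number of times $a$ appears in the triangle of Stirling numbers of the second kind. $W$ is the (principal branch of the) Lambert $W$ function, defined for $x>0$ as the unique positive solution $w$ of $we^{w}=x$. $\log$ is the natural logarithm. *)

theory Defs
  imports
    Complex_Main
    "HOL-Library.Landau_Symbols"
    "HOL-Combinatorics.Stirling"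
begin

definition M2_pairs :: "nat \<Rightarrow> (nat \<times> nat) set"
  where "M2_pairs a = {(n, k). Stirling n k = a}"

text \<open>Since \<open>card\<close> is 0 on infinite sets (which is what happens for \<open>a \<le> 1\<close>), a bound on
  \<open>M2 a\<close> has to be accompanied by finiteness of \<open>M2_pairs a\<close>.\<close>

definition M2 :: "nat \<Rightarrow> nat"
  where "M2 a = card (M2_pairs a)"

text \<open>Principal branch on the positive reals only; unspecified for \<open>x \<le> 0\<close>.\<close>

definition Lambert_W :: "real \<Rightarrow> real"
  where "Lambert_W x = (THE w. w > 0 \<and> w * exp w = x)"

end

theory Submission
  imports Defs "HOL-Real_Asymp.Real_Asymp"
begin

text \<open>
  For \<open>a \<ge> 2\<close> every occurrence \<open>(n, k)\<close> of \<open>a\<close> satisfies \<open>2 \<le> k < n\<close>. The Stirling numbers increase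
  strictly down the columns (\<open>k\<close> fixed) and along the diagonals (\<open>n - k\<close> fixed), so an occurrence is
  determined by \<open>k\<close> and also by \<open>n - k\<close>. Since \<open>Stirling n k \<ge> k ^ (n - k)\<close>, the number
  \<open>m = min k (n - k)\<close> satisfies \<open>m ^ m \<le> a\<close>, which forces \<open>m \<le> x\<close> with
  \<open>x = ln a / W (ln a / 2) = 2 * exp (W (ln a / 2))\<close>. Hence there are at most \<open>2 * x\<close> occurrences.
\<close>

text \<open>Each step down column \<open>k\<close> multiplies the entry by at least \<open>k\<close>
  (a new element may join any of the \<open>k\<close> blocks), starting from
  \<open>Stirling k k = 1\<close>.\<close>

lemma Stirling_ge_power: "k ^ d \<le> Stirling (k + d) k"
proof (induction d)
  case (Suc d)
  show ?case
  proof (cases k)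
    case (Suc j)
    have "k ^ Suc d \<le> k * Stirling (k + d) k"
      using Suc.IH by simp
    also have "\<dots> \<le> Stirling (k + Suc d) k"
      using Suc by simp
    finally show ?thesis .
  qed simp
qed simp

lemma Stirling_pos: "k \<ge> 1 \<Longrightarrow> k \<le> n \<Longrightarrow> Stirling n k > 0"
  using Stirling_ge_power[of k "n - k"] by (auto intro: less_le_trans[rotated])

text \<open>A positive entry gets multiplied by at least \<open>k\<close>, so growth is strict once
  \<open>k\<close> exceeds 1; column 1 is constant.\<close>

lemma Stirling_column_strict_mono:
  assumes "k \<ge> 2"
  shows "strict_mono (\<lambda>d. Stirling (k + d) k)"
proof (rule strict_mono_Suc_iff[THEN iffD2], rule allI)
  fix d
  obtain j where j: "k = Suc j"
    using assms by (cases k) auto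
  have "Stirling (k + d) k > 0"
    using assms by (intro Stirling_pos) auto
  then have "Stirling (k + d) k < k * Stirling (k + d) k"
    using assms by simp
  also have "\<dots> \<le> Stirling (k + Suc d) k"
    using j by simp
  finally show "Stirling (k + d) k < Stirling (k + Suc d) k" .
qed

text \<open>The recurrence adds \<open>Suc k * Stirling (k + d) (Suc k)\<close> to the previous
  diagonal entry; this is positive exactly because \<open>d\<close> is at least 1.\<close>

lemma Stirling_diagonal_strict_mono:
  assumes "d \<ge> 1"
  shows "strict_mono (\<lambda>k. Stirling (k + d) k)"
proof (rule strict_mono_Suc_iff[THEN iffD2], rule allI)
  fix k
  have "Stirling (k + d) (Suc k) > 0"
    using assms by (intro Stirling_pos) auto
  then show "Stirling (k + d) k < Stirling (Suc k + d) (Suc k)"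
    by simp
qed

text \<open>Columns 0 and 1, the main diagonal and everything beyond it contain only the values 0
  and 1.\<close>

lemma M2_pairs_bounds:
  assumes "a \<ge> 2" "(n, k) \<in> M2_pairs a"
  shows "k \<ge> 2" "k < n"
proof -
  have eq: "Stirling n k = a"
    using assms by (simp add: M2_pairs_def)
  have "k \<noteq> 0"
    using eq assms(1) by (intro notI; cases n; simp)
  moreover have "k \<noteq> 1"
    using eq assms(1) by (intro notI; cases n; simp del: Stirling.simps(4))
  ultimately show "k \<ge> 2" by simp
  have "\<not> n < k" "n \<noteq> k"
    using eq assms(1) by auto
  then show "k < n" by simp
qed

lemma inj_on_snd_M2_pairs:
  assumes "a \<ge> 2"
  shows "inj_on snd (M2_pairs a)"
proof (rule inj_onI, clarsimp)
  fix n n' k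
  assume *: "(n, k) \<in> M2_pairs a" "(n', k) \<in> M2_pairs a"
  note b = M2_pairs_bounds[OF assms *(1)] M2_pairs_bounds[OF assms *(2)]
  have "Stirling (k + (n - k)) k = Stirling (k + (n' - k)) k"
    using * b by (simp add: M2_pairs_def)
  then have "n - k = n' - k"
    using strict_mono_eq[OF Stirling_column_strict_mono[OF b(1)]] by blast
  then show "n = n'"
    using b by simp
qed

lemma inj_on_diff_M2_pairs:
  assumes "a \<ge> 2"
  shows "inj_on (\<lambda>(n, k). n - k) (M2_pairs a)"
proof (rule inj_onI, clarify)
  fix n k n' k'
  assume *: "(n, k) \<in> M2_pairs a" "(n', k') \<in> M2_pairs a" and d: "n - k = n' - k'"
  note b = M2_pairs_bounds[OF assms *(1)] M2_pairs_bounds[OF assms *(2)]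
  have n: "n = k + (n - k)" "n' = k' + (n - k)"
    using b d by simp_all
  have "Stirling (k + (n - k)) k = Stirling (k' + (n - k)) k'"
    using * unfolding n(1)[symmetric] n(2)[symmetric] by (simp add: M2_pairs_def)
  moreover have "n - k \<ge> 1"
    using b by simp
  ultimately have "k = k'"
    using strict_mono_eq[OF Stirling_diagonal_strict_mono] by blast
  then show "n = n' \<and> k = k'"
    using n by simp
qed

lemma Lambert_W_props:
  assumes "x > 0"
  shows "Lambert_W x > 0" "Lambert_W x * exp (Lambert_W x) = x"
proof -
  have less: "v * exp v < w * exp w" if "0 < v" "v < w" for v w :: real
    using that by (intro mult_strict_mono) auto
  \<comment> \<open>Intermediate value theorem on \<open>[0, x]\<close>: the right endpoint suffices
    since \<open>x * exp x\<close> is at least \<open>x\<close>.\<close>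
  have "\<exists>w\<ge>0. w \<le> x \<and> w * exp w = x"
    using assms by (intro IVT') (auto intro!: continuous_intros)
  then obtain w where "w \<ge> 0" "w * exp w = x"
    by blast
  with assms have w: "w > 0 \<and> w * exp w = x"
    by (cases "w = 0") auto
  have "\<exists>!w. w > 0 \<and> w * exp w = x"
  proof (rule ex1I, rule w)
    fix v assume "v > 0 \<and> v * exp v = x"
    with w less[of v w] less[of w v] show "v = w"
      by (cases v w rule: linorder_cases) auto
  qed
  from theI'[OF this] show "Lambert_W x > 0" "Lambert_W x * exp (Lambert_W x) = x"
    unfolding Lambert_W_def by auto
qed

lemma self_power_le_imp_le_Lambert_W:
  assumes "m \<ge> 1" "m ^ m \<le> a" "a \<ge> 2"
  shows "real m \<le> ln (real a) / Lambert_W (1/2 * ln (real a))"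
proof -
  define w where "w = Lambert_W (1/2 * ln (real a))"
  have L: "ln (real a) > 0"
    using assms by simp
  have w: "w > 0" "w * exp w = 1/2 * ln (real a)"
    using Lambert_W_props[of "1/2 * ln (real a)"] L unfolding w_def by auto
  have "real m \<le> 2 * exp w"
  proof (rule ccontr)
    assume "\<not> ?thesis"
    then have m: "real m > 2 * exp w" by simp
    \<comment> \<open>Only \<open>exp w < m\<close> is used in the logarithm, discarding
      \<open>ln 2\<close>; the factor 2 is kept outside, where \<open>2 * exp w * w\<close> equals
      \<open>ln a\<close>.\<close>
    have "w = ln (exp w)" by simp
    also have "\<dots> < ln (real m)"
      using m exp_gt_zero[of w] assms(1) by (subst ln_less_cancel_iff) auto
    finally have "2 * exp w * w < real m * ln (real m)"
      using m w(1) assms(1) by (intro mult_strict_mono) auto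
    also have "\<dots> = ln (real (m ^ m))"
      using assms by (simp add: ln_realpow)
    also have "\<dots> \<le> ln (real a)"
      using assms by (subst ln_le_cancel_iff) (auto simp del: of_nat_power)
    finally show False
      using w(2) by (simp add: algebra_simps)
  qed
  also have "2 * exp w = ln (real a) / w"
    using w by (simp add: field_simps)
  finally show ?thesis
    unfolding w_def .
qed

lemma M2_bound:
  assumes a: "a \<ge> 2"
  shows "finite (M2_pairs a)"
    and "real (M2 a) \<le> 2 * (ln (real a) / Lambert_W (1/2 * ln (real a)))"
proof -
  define x where "x = ln (real a) / Lambert_W (1/2 * ln (real a))"
  define N where "N = nat \<lfloor>x\<rfloor>"
  \<comment> \<open>Occurrences with small \<open>k\<close> go to \<open>A\<close>, those with small
    \<open>n - k\<close> to \<open>B\<close>; the sets may overlap, and each injects into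
    \<open>{1..N}\<close>.\<close>
  define A where "A = {p \<in> M2_pairs a. snd p \<in> {1..N}}"
  define B where "B = {p \<in> M2_pairs a. (case p of (n, k) \<Rightarrow> n - k) \<in> {1..N}}"
  \<comment> \<open>\<open>nat\<close> sends negative integers to 0, so \<open>N \<le> x\<close>
    relies on this sign.\<close>
  have x: "x \<ge> 0"
    using a Lambert_W_props(1)[of "1/2 * ln (real a)"] by (simp add: x_def)
  have "p \<in> A \<union> B" if "p \<in> M2_pairs a" for p
  proof -
    obtain n k where p: "p = (n, k)" by (cases p)
    note b = M2_pairs_bounds[OF a that[unfolded p]]
    define m where "m = min k (n - k)"
    have m: "m \<ge> 1"
      using b by (simp add: m_def)
    \<comment> \<open>First the base grows from \<open>m\<close> to \<open>k\<close>, then the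
      exponent from \<open>m\<close> to \<open>n - k\<close>.\<close>
    have "m ^ m \<le> k ^ m"
      by (intro power_mono) (auto simp: m_def)
    also have "\<dots> \<le> k ^ (n - k)"
      using b by (intro power_increasing) (auto simp: m_def)
    also have "\<dots> \<le> Stirling n k"
      using Stirling_ge_power[of k "n - k"] b by simp
    also have "\<dots> = a"
      using that by (simp add: p M2_pairs_def)
    finally have "real m \<le> x"
      unfolding x_def by (intro self_power_le_imp_le_Lambert_W m a)
    then have "m \<le> N"
      unfolding N_def by (simp add: le_nat_floor)
    then show ?thesis
      using that b by (auto simp: A_def B_def p m_def min_def split: if_splits)
  qed
  then have AB: "M2_pairs a = A \<union> B"
    by (auto simp: A_def B_def)
  have injA: "inj_on snd A"
    by (rule inj_on_subset[OF inj_on_snd_M2_pairs[OF a]]) (auto simp: A_def)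
  have injB: "inj_on (\<lambda>(n, k). n - k) B"
    by (rule inj_on_subset[OF inj_on_diff_M2_pairs[OF a]]) (auto simp: B_def)
  have A: "finite A" "card A \<le> card {1..N}"
    by (rule inj_on_finite[OF injA, of "{1..N}"] card_inj_on_le[OF injA]; auto simp: A_def)+
  have B: "finite B" "card B \<le> card {1..N}"
    by (rule inj_on_finite[OF injB, of "{1..N}"] card_inj_on_le[OF injB]; auto simp: B_def)+
  show "finite (M2_pairs a)"
    using A B AB by simp
  have "M2 a \<le> N + N"
    using card_Un_le[of A B] A B unfolding M2_def AB by simp
  then have "real (M2 a) \<le> 2 * real N"
    by linarith
  also have "real N \<le> x"
    using x unfolding N_def by simp
  finally show "real (M2 a) \<le> 2 * (ln (real a) / Lambert_W (1/2 * ln (real a)))"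
    by (simp add: x_def)
qed

text \<open>Taking logarithms in \<open>w * exp w = x\<close> gives \<open>w = ln x - ln w\<close>.
  For \<open>w \<ge> 1\<close> this yields \<open>w \<le> ln x\<close>, which fed back into
  \<open>ln w\<close> gives the bound.\<close>

lemma Lambert_W_ge:
  assumes "x \<ge> exp 1"
  shows "Lambert_W x \<ge> ln x - ln (ln x)"
proof -
  define w where "w = Lambert_W x"
  have x: "x > 0"
    using assms exp_gt_zero[of 1] by linarith
  have w: "w > 0" "w * exp w = x"
    using Lambert_W_props[OF x] by (auto simp: w_def)
  have "w \<ge> 1"
  proof (rule ccontr)
    assume "\<not> w \<ge> 1"
    then have "w * exp w < 1 * exp 1"
      using w(1) by (intro mult_strict_mono) auto
    with w(2) assms show False by simp
  qed
  have eq: "ln x = ln w + w"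
    using w(1) by (simp add: ln_mult flip: w(2))
  then have "w \<le> ln x"
    using \<open>w \<ge> 1\<close> by simp
  then have "ln w \<le> ln (ln x)"
    using w(1) by simp
  with eq show ?thesis
    by (simp add: w_def)
qed

lemma M2_bigo:
  "(\<lambda>a::nat. real (M2 a)) \<in> O[at_top](\<lambda>a. ln (real a) / (ln (ln (real a)) - ln (ln (ln (real a)))))"
proof (rule bigoI)
  let ?D = "\<lambda>a::nat. ln (ln (real a)) - ln (ln (ln (real a)))"
  have ev: "\<forall>\<^sub>F a::nat in at_top. 1/2 * ln (real a) \<ge> exp 1"
    "\<forall>\<^sub>F a::nat in at_top. ?D a > 0"
    \<comment> \<open>Halving \<open>ln a\<close> changes the difference of logarithms only by a
      bounded amount, while \<open>?D a\<close> tends to infinity; the factor 1/2 absorbs the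
      change.\<close>
    "\<forall>\<^sub>F a::nat in at_top. ln (1/2 * ln (real a)) - ln (ln (1/2 * ln (real a))) \<ge> 1/2 * ?D a"
    by real_asymp+
  \<comment> \<open>The constant 4 is the 2 of \<open>M2_bound\<close> times the 2 lost in
    \<open>W \<ge> 1/2 * ?D a\<close>.\<close>
  show "\<forall>\<^sub>F a in at_top. norm (real (M2 a)) \<le> 4 * norm (ln (real a) / ?D a)"
    using ev eventually_ge_at_top[of 2]
  proof eventually_elim
    case (elim a)
    define W where "W = Lambert_W (1/2 * ln (real a))"
    have L: "ln (real a) > 0"
      using elim by simp
    have W: "W \<ge> 1/2 * ?D a"
      using Lambert_W_ge[OF elim(1)] elim(3) unfolding W_def by linarith
    have "real (M2 a) \<le> 2 * (ln (real a) / W)"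
      using M2_bound(2)[OF elim(4)] by (simp add: W_def)
    also have "\<dots> \<le> 2 * (ln (real a) / (1/2 * ?D a))"
      using W L elim(2) by (intro mult_left_mono divide_left_mono mult_pos_pos) auto
    finally show ?case
      using L elim(2) by simp
  qed
qed

theorem theorem1:
  shows "(\<forall>a::nat. a \<ge> 2 \<longrightarrow>
            finite (M2_pairs a) \<and>
            real (M2 a) \<le> 2 + 2 * (ln (real a) / Lambert_W (1/2 * ln (real a)))) \<and>
         (\<lambda>a::nat. real (M2 a)) \<in> O[at_top](\<lambda>a. ln (real a) / (ln (ln (real a)) - ln (ln (ln (real a)))))"
proof (intro conjI allI impI)
  fix a :: nat
  assume "a \<ge> 2"
  from M2_bound[OF this] show "finite (M2_pairs a)"
    "real (M2 a) \<le> 2 + 2 * (ln (real a) / Lambert_W (1/2 * ln (real a)))"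
    by linarith+
qed (rule M2_bigo)

end
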